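(* All the zeros of the polynomials $Q_n^{(1)}(z)$ ($n\geq 1$) and $R_n^{(1)}(z)$ ($n\geq 0$) lie on the vertical line $\mathrm{Re}(z)=-2$ in the complex plane. The zeros are all nonreal, with the exception of the zero $z=-2$ of $Q_{2n}^{(1)}$ for all $n\ge 1$ and the zero $z=-2$ of $R_{2n+1}^{(1)}$ for all $n\geq 0$.
   Context: Let $Z=(w,x,y,z)$ be a quadruple of variables. The polynomials $S(n;Z)$, $n\ge 0$, are defined by the generating function $$\sum_{n=0}^{\infty}S(n;Z)q^n = \prod_{j=0}^{\infty}\left(1+wq^{3^j}\right)\left(1+xq^{3^j}\right)\left(1+yq^{3^j}+zq^{2\cdot 3^j}\right).$$ Define $Q_n(Z):=S(\tfrac{3^n-3}{2};Z)$ for $n\geq 1$ and $R_n(Z):=S(\tfrac{3^n-1}{2};Z)$ for $n\geq 0$, and $Q_n^{(1)}(z):=Q_n(1,1,z,1)$, $R_n^{(1)}(z):=R_n(1,1,z,1)$. *)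

theory Defs
  imports "HOL-Analysis.Analysis"
begin

text \<open>
  The quadruple \<open>Z = (w, x, y, z)\<close> consists of elements of an arbitrary commutative ring.
  Taking for them the indeterminates of a polynomial ring gives the polynomial \<open>S(n; Z)\<close> itself;
  other choices give its value at \<open>Z\<close>, since \<open>S\<close> commutes with ring
  homomorphisms (lemma \<open>S_hom\<close>).
  The infinite product is the limit of the partial products in the
  \<open>q\<close>-adic topology of formal power series; it converges by lemma \<open>S_has_prod\<close>.
\<close>

definition S_factor :: "'a::comm_ring_1 \<Rightarrow> 'a \<Rightarrow> 'a \<Rightarrow> 'a \<Rightarrow> nat \<Rightarrow> 'a fps" where
  "S_factor w x y z j =
     (1 + fps_const w * fps_X ^ (3 ^ j)) * (1 + fps_const x * fps_X ^ (3 ^ j)) *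
     (1 + fps_const y * fps_X ^ (3 ^ j) + fps_const z * fps_X ^ (2 * 3 ^ j))"

definition S :: "nat \<Rightarrow> 'a::comm_ring_1 \<Rightarrow> 'a \<Rightarrow> 'a \<Rightarrow> 'a \<Rightarrow> 'a" where
  "S n w x y z = fps_nth (\<Prod>j. S_factor w x y z j) n"

text \<open>Both indices are exact integers; \<open>Q\<close> is only meaningful for \<open>n \<ge> 1\<close>.\<close>

definition Q :: "nat \<Rightarrow> 'a::comm_ring_1 \<Rightarrow> 'a \<Rightarrow> 'a \<Rightarrow> 'a \<Rightarrow> 'a" where
  "Q n w x y z = S ((3 ^ n - 3) div 2) w x y z"

definition R :: "nat \<Rightarrow> 'a::comm_ring_1 \<Rightarrow> 'a \<Rightarrow> 'a \<Rightarrow> 'a \<Rightarrow> 'a" where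
  "R n w x y z = S ((3 ^ n - 1) div 2) w x y z"

text \<open>\<open>[:0, 1:]\<close> is the indeterminate \<open>z\<close> of \<open>\<complex>[z]\<close>.\<close>

definition Q1 :: "nat \<Rightarrow> complex poly" where
  "Q1 n = Q n 1 1 [:0, 1:] 1"

definition R1 :: "nat \<Rightarrow> complex poly" where
  "R1 n = R n 1 1 [:0, 1:] 1"

lemma S_factor_0: "fps_nth (S_factor w x y z j) 0 = 1"
  by (simp add: S_factor_def)

lemma S_factor_low:
  assumes "0 < k" "k < 3 ^ j"
  shows "fps_nth (S_factor w x y z j) k = 0"
proof -
  have "S_factor w x y z j = 1 + fps_X ^ (3 ^ j) *
     (fps_const w + (1 + fps_const w * fps_X ^ (3 ^ j)) * fps_const x
      + (1 + fps_const w * fps_X ^ (3 ^ j)) * (1 + fps_const x * fps_X ^ (3 ^ j)) *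
        (fps_const y + fps_const z * fps_X ^ (3 ^ j)))"
    unfolding S_factor_def mult_2 power_add by (simp add: algebra_simps)
  then show ?thesis using assms by (simp add: fps_X_power_mult_nth)
qed

lemma S_prod_nth_Suc:
  assumes "k < 3 ^ Suc N"
  shows "fps_nth (\<Prod>j\<le>Suc N. S_factor w x y z j) k = fps_nth (\<Prod>j\<le>N. S_factor w x y z j) k"
proof -
  have "fps_nth ((\<Prod>j\<le>N. S_factor w x y z j) * S_factor w x y z (Suc N)) k
      = (\<Sum>i=0..k. fps_nth (\<Prod>j\<le>N. S_factor w x y z j) i *
           (if i = k then 1 else 0))"
    unfolding fps_mult_nth
  proof (intro sum.cong refl)
    fix i assume "i \<in> {0..k}"
    then have "fps_nth (S_factor w x y z (Suc N)) (k - i) = (if i = k then 1 else 0)"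
      using assms by (cases "i = k") (simp_all add: S_factor_0 S_factor_low del: power_Suc)
    then show "fps_nth (\<Prod>j\<le>N. S_factor w x y z j) i * fps_nth (S_factor w x y z (Suc N)) (k - i)
        = fps_nth (\<Prod>j\<le>N. S_factor w x y z j) i * (if i = k then 1 else 0)"
      by simp
  qed
  also have "\<dots> = fps_nth (\<Prod>j\<le>N. S_factor w x y z j) k"
    by (simp add: if_distrib cong: if_cong)
  finally show ?thesis by simp
qed

lemma S_prod_nth_stable:
  assumes "k \<le> N"
  shows "fps_nth (\<Prod>j\<le>N. S_factor w x y z j) k = fps_nth (\<Prod>j\<le>k. S_factor w x y z j) k"
  using assms
proof (induction N rule: dec_induct)
  case base
  then show ?case by simp
next
  case (step N)
  have "k < 3 ^ Suc N"
  proof -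
    have "k < Suc N" using step.hyps by simp
    also have "Suc N < 2 ^ Suc N" by (rule less_exp)
    also have "(2::nat) ^ Suc N \<le> 3 ^ Suc N" by (rule power_mono) simp_all
    finally show ?thesis .
  qed
  then show ?case using step.IH S_prod_nth_Suc[of k N w x y z] by (simp only:)
qed

lemma S_has_prod:
  fixes w x y z :: "'a::comm_ring_1"
  shows "S_factor w x y z has_prod Abs_fps (\<lambda>n. S n w x y z)"
proof -
  define P where "P = Abs_fps (\<lambda>k. fps_nth (\<Prod>j\<le>k. S_factor w x y z j) k)"
  have P_nth: "fps_nth P k = fps_nth (\<Prod>j\<le>k. S_factor w x y z j) k" for k
    by (simp add: P_def)
  have ev: "eventually (\<lambda>N. fps_nth (\<Prod>j\<le>N. S_factor w x y z j) k = fps_nth P k) sequentially" for k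
    unfolding eventually_sequentially P_nth using S_prod_nth_stable by blast
  have lim: "(\<lambda>N. \<Prod>j\<le>N. S_factor w x y z j) \<longlonglongrightarrow> P"
    unfolding tendsto_fps_iff using ev by blast
  have "fps_nth P 0 = 1" by (simp add: P_nth S_factor_0)
  then have "P \<noteq> 0" by auto
  with lim have hp: "S_factor w x y z has_prod P"
    by (simp add: has_prod_def raw_has_prod_def)
  have nz: "S_factor w x y z j \<noteq> 0" for j
    using S_factor_0[of w x y z j] by auto
  have "prodinf (S_factor w x y z) = P"
    unfolding prodinf_def
  proof (rule the_equality[where P = "\<lambda>p. S_factor w x y z has_prod p", OF hp])
    fix p assume "S_factor w x y z has_prod p"
    then have "(\<lambda>N. \<Prod>j\<le>N. S_factor w x y z j) \<longlonglongrightarrow> p"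
      using nz by (auto simp: has_prod_def raw_has_prod_def)
    with lim show "p = P" using LIMSEQ_unique by blast
  qed
  then have "P = Abs_fps (\<lambda>n. S n w x y z)"
    unfolding S_def by (simp only: fps_nth_inverse)
  with hp show ?thesis by simp
qed

lemma S_eq_nth_prod:
  fixes w x y z :: "'a::comm_ring_1"
  shows "S n w x y z = fps_nth (\<Prod>j\<le>n. S_factor w x y z j) n"
proof -
  have "S_factor w x y z j \<noteq> 0" for j
    using S_factor_0[of w x y z j] by auto
  then have "(\<lambda>N. \<Prod>j\<le>N. S_factor w x y z j) \<longlonglongrightarrow> Abs_fps (\<lambda>n. S n w x y z)"
    using S_has_prod[of w x y z] by (auto simp: has_prod_def raw_has_prod_def)
  then have "eventually (\<lambda>N. fps_nth (\<Prod>j\<le>N. S_factor w x y z j) n = S n w x y z) sequentially"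
    unfolding tendsto_fps_iff by simp
  then obtain N where "N \<ge> n" "fps_nth (\<Prod>j\<le>N. S_factor w x y z j) n = S n w x y z"
    unfolding eventually_sequentially by (metis nat_le_linear)
  then show ?thesis by (metis S_prod_nth_stable)
qed

lemma S_hom:
  fixes h :: "'a::comm_ring_1 \<Rightarrow> 'b::comm_ring_1"
  assumes add: "\<And>a b. h (a + b) = h a + h b" and mult: "\<And>a b. h (a * b) = h a * h b"
    and one: "h 1 = 1"
  shows "h (S n w x y z) = S n (h w) (h x) (h y) (h z)"
proof -
  have zero: "h 0 = 0" using add[of 0 0] by simp
  have sum: "h (sum f A) = (\<Sum>i\<in>A. h (f i))" for f :: "nat \<Rightarrow> 'a" and A
    by (induction A rule: infinite_finite_induct) (simp_all add: add zero)
  define H where "H F = Abs_fps (\<lambda>k. h (fps_nth F k))" for F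
  have H_add: "H (F + G) = H F + H G" for F G
    by (simp add: H_def fps_eq_iff add)
  have H_mult: "H (F * G) = H F * H G" for F G
    by (simp add: H_def fps_eq_iff fps_mult_nth mult sum)
  have H_const: "H (fps_const c) = fps_const (h c)" for c
    by (simp add: H_def fps_eq_iff zero)
  have H_one: "H 1 = 1" by (simp add: H_def fps_eq_iff zero one)
  have H_X: "H (fps_X ^ m) = fps_X ^ m" for m
    by (simp add: H_def fps_eq_iff zero one fps_X_power_nth)
  have "H (S_factor w x y z j) = S_factor (h w) (h x) (h y) (h z) j" for j
    by (simp add: S_factor_def H_add H_mult H_const H_one H_X)
  then have "H (\<Prod>j\<le>N. S_factor w x y z j) = (\<Prod>j\<le>N. S_factor (h w) (h x) (h y) (h z) j)" for N
    by (induction N) (simp_all add: H_mult)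
  then have "h (fps_nth (\<Prod>j\<le>n. S_factor w x y z j) n)
      = fps_nth (\<Prod>j\<le>n. S_factor (h w) (h x) (h y) (h z) j) n"
    by (metis H_def fps_nth_Abs_fps)
  then show ?thesis by (simp add: S_eq_nth_prod)
qed

end

theory Submission
  imports Defs "HOL-Computational_Algebra.Formal_Laurent_Series"
begin

text \<open>
  The generating function \<open>F(q)\<close> satisfies \<open>F(q) = P(q) F(q\<^sup>3)\<close>, where \<open>P\<close> is the factor \<open>j = 0\<close> of the
  product. Comparing coefficients expresses \<open>S(3m)\<close> and \<open>S(3m + 1)\<close> as linear combinations of \<open>S(m)\<close>
  and \<open>S(m - 1)\<close> (lemmas \<open>S_triple\<close> and \<open>S_triple_plus_1\<close>). The indices
  \<open>r\<^sub>n = (3\<^sup>n - 1)/2\<close> of \<open>R\<^sub>n\<close> and \<open>r\<^sub>n - 1\<close> of \<open>Q\<^sub>n\<close> are made for this recurrence, because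
  \<open>r\<^bsub>n+1\<^esub> = 3 r\<^sub>n + 1\<close> and \<open>r\<^bsub>n+1\<^esub> - 1 = 3 r\<^sub>n\<close>: for \<open>n \<ge> 1\<close> the pair
  \<open>(R\<^sub>n, Q\<^sub>n)\<close> is obtained from \<open>(1, 0)\<close> by applying a fixed 2-by-2 matrix \<open>n\<close> times.

  For \<open>w = x = z = 1\<close> and \<open>a = y + 2\<close> the polynomial \<open>P\<close> is palindromic,
  \<open>P(q) = (1 + q)\<^sup>2 (1 + y q + q\<^sup>2) = 1 + a q + (2a - 2) q\<^sup>2 + a q\<^sup>3 + q\<^sup>4\<close>, so this matrix is symmetric
  with both diagonal entries \<open>a\<close> and both other entries \<open>1\<close>. It is diagonalised by sum and difference, and
  \<open>R\<^sub>n + Q\<^sub>n = (a + 1)\<^sup>n\<close>, \<open>R\<^sub>n - Q\<^sub>n = (a - 1)\<^sup>n\<close> (lemma \<open>R_Q_closed_form\<close>).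

  At a zero of \<open>R\<^sub>n\<close> or \<open>Q\<^sub>n\<close> the powers \<open>(a + 1)\<^sup>n\<close> and \<open>(a - 1)\<^sup>n\<close> therefore agree up to sign, and
  \<open>n \<ge> 1\<close> because \<open>R\<^sub>0 = 1\<close>. Hence \<open>a\<close> is equidistant from \<open>1\<close> and \<open>-1\<close>, that is, \<open>Re a = 0\<close>. A real zero has \<open>a = 0\<close>, and
  there \<open>1\<close> and \<open>(-1)\<^sup>n\<close> decide by parity which of the two polynomials vanishes.
\<close>

unbundle fps_syntax

lemma S_factor_Suc:
  fixes w x y z :: "'a::idom"
  shows "S_factor w x y z (Suc j) = S_factor w x y z j oo fps_X ^ 3"
proof -
  have "fps_X ^ k oo fps_X ^ 3 = (fps_X ^ (3 * k) :: 'a fps)" for k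
    by (simp add: fps_compose_power[symmetric] power_mult)
  then show ?thesis
    by (simp add: S_factor_def fps_compose_mult_distrib fps_compose_add_distrib ac_simps)
qed

text \<open>
  Composition with \<open>q\<^sup>3\<close> shifts the product by one factor. The coefficient of \<open>q\<^sup>n\<close> only involves a partial
  product, which keeps the argument free of convergence questions about composition.
\<close>

lemma S_gf_functional_equation:
  fixes w x y z :: "'a::idom"
  defines "F \<equiv> Abs_fps (\<lambda>n. S n w x y z)"
  shows "F = S_factor w x y z 0 * (F oo fps_X ^ 3)"
proof (rule fps_ext)
  fix n
  define p where "p = (\<Prod>j\<le>n. S_factor w x y z j)"
  have F_nth: "fps_nth F k = fps_nth p k" if "k \<le> n" for k
    using S_prod_nth_stable[OF that, of w x y z] by (simp add: F_def p_def S_eq_nth_prod)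
  have "p oo fps_X ^ 3 = (\<Prod>j\<le>n. S_factor w x y z (Suc j))"
    unfolding p_def by (simp add: fps_compose_prod_distrib S_factor_Suc)
  then have "S_factor w x y z 0 * (p oo fps_X ^ 3) = (\<Prod>j\<le>Suc n. S_factor w x y z j)"
    by (simp only: prod.atMost_Suc_shift)
  moreover have "fps_nth F n = fps_nth (\<Prod>j\<le>Suc n. S_factor w x y z j) n"
    using S_prod_nth_stable[of n "Suc n" w x y z] by (simp add: F_def S_eq_nth_prod del: prod.atMost_Suc)
  ultimately have "fps_nth F n = fps_nth (S_factor w x y z 0 * (p oo fps_X ^ 3)) n"
    by simp
  also have "\<dots> = fps_nth (S_factor w x y z 0 * (F oo fps_X ^ 3)) n"
    unfolding fps_mult_nth by (intro sum.cong refl) (simp add: fps_nth_compose_X_power F_nth)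
  finally show "fps_nth F n = fps_nth (S_factor w x y z 0 * (F oo fps_X ^ 3)) n" .
qed

lemma S_factor_0_expand:
  "S_factor w x y z 0 = 1 + fps_X ^ 1 * fps_const (w + x + y)
    + fps_X ^ 2 * fps_const (w * x + w * y + x * y + z)
    + fps_X ^ 3 * fps_const (w * x * y + w * z + x * z) + fps_X ^ 4 * fps_const (w * x * z)"
  by (simp add: S_factor_def algebra_simps power2_eq_square power3_eq_cube power4_eq_xxxx
      flip: fps_const_add fps_const_mult)

text \<open>
  Only the exponents congruent to \<open>0\<close> modulo \<open>3\<close> occur in \<open>F(q\<^sup>3)\<close>, so of the five coefficients of
  \<open>P(q)\<close> those of \<open>q\<^sup>0\<close> and \<open>q\<^sup>3\<close> contribute to the first identity, those of \<open>q\<^sup>1\<close> and \<open>q\<^sup>4\<close> to the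
  second. The argument \<open>Suc m\<close> keeps the index of \<open>S(m - 1)\<close> nonnegative.
\<close>

lemma
  fixes w x y z :: "'a::idom"
  shows S_triple: "S (3 * Suc m) w x y z = S (Suc m) w x y z
      + (w * x * y + w * z + x * z) * S m w x y z"
    and S_triple_plus_1: "S (3 * Suc m + 1) w x y z = (w + x + y) * S (Suc m) w x y z
      + w * x * z * S m w x y z"
proof -
  define F where "F = Abs_fps (\<lambda>n. S n w x y z)"
  define G where "G = F oo fps_X ^ 3"
  have G: "fps_nth G n = (if 3 dvd n then S (n div 3) w x y z else 0)" for n
    by (simp add: G_def F_def fps_nth_compose_X_power)
  have "S n w x y z = fps_nth (S_factor w x y z 0 * G) n" for n
    using S_gf_functional_equation[of w x y z] unfolding G_def F_def by (metis fps_nth_Abs_fps)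
  then have S: "S n w x y z = fps_nth G n + (if n < 1 then 0 else (w + x + y) * fps_nth G (n - 1))
    + (if n < 2 then 0 else (w * x + w * y + x * y + z) * fps_nth G (n - 2))
    + (if n < 3 then 0 else (w * x * y + w * z + x * z) * fps_nth G (n - 3))
    + (if n < 4 then 0 else w * x * z * fps_nth G (n - 4))" for n
    unfolding S_factor_0_expand
    by (simp add: distrib_right mult.assoc fps_X_power_mult_nth
        del: fps_const_add fps_const_mult power_one_right)
  have not_dvd: "\<not> 3 dvd 3 * k + 1" "\<not> 3 dvd 3 * k + 2" for k :: nat
    by presburger+
  have G_mod: "fps_nth G (3 * k) = S k w x y z" "fps_nth G (3 * k + 1) = 0"
    "fps_nth G (3 * k + 2) = 0" for k
    by (simp add: G, simp_all only: G not_dvd if_False)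
  have "3 * Suc m - 1 = 3 * m + 2" "3 * Suc m - 2 = 3 * m + 1" "3 * Suc m - 3 = 3 * m"
    "\<not> 3 * Suc m < 1" "\<not> 3 * Suc m < 2" "\<not> 3 * Suc m < 3"
    by simp_all
  \<comment> \<open>The index here is congruent to \<open>2\<close> modulo \<open>3\<close> unless it is negative.\<close>
  moreover have "(if 3 * Suc m < 4 then 0 else w * x * z * fps_nth G (3 * Suc m - 4)) = 0"
  proof (cases m)
    case (Suc k)
    then have "3 * Suc m - 4 = 3 * k + 2"
      by simp
    then show ?thesis
      by (simp only: G_mod mult_zero_right if_cancel)
  qed simp
  ultimately show "S (3 * Suc m) w x y z = S (Suc m) w x y z + (w * x * y + w * z + x * z) * S m w x y z"
    using S[of "3 * Suc m"] by (simp only: G_mod if_False mult_zero_right add_0_right)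
  have "3 * Suc m + 1 - 1 = 3 * Suc m" "3 * Suc m + 1 - 2 = 3 * m + 2"
    "3 * Suc m + 1 - 3 = 3 * m + 1" "3 * Suc m + 1 - 4 = 3 * m"
    "\<not> 3 * Suc m + 1 < 1" "\<not> 3 * Suc m + 1 < 2" "\<not> 3 * Suc m + 1 < 3" "\<not> 3 * Suc m + 1 < 4"
    by simp_all
  then show "S (3 * Suc m + 1) w x y z = (w + x + y) * S (Suc m) w x y z + w * x * z * S m w x y z"
    using S[of "3 * Suc m + 1"] by (simp only: G_mod if_False mult_zero_right add_0_right add_0_left)
qed

lemma S_0: "S 0 w x y z = 1"
  by (simp add: S_eq_nth_prod S_factor_0)

lemma S_1: "S 1 w x y z = w + x + y"
  by (simp add: S_eq_nth_prod S_factor_def)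

lemma R_0: "R 0 w x y z = 1" and R_1: "R 1 w x y z = w + x + y" and Q_1: "Q 1 w x y z = 1"
  using S_1[of w x y z] by (simp_all add: R_def Q_def S_0)

text \<open>For \<open>n \<ge> 1\<close> all divisions and subtractions in the indices are exact.\<close>

lemma index_shapes:
  fixes n :: nat
  assumes "n \<ge> 1"
  obtains m where "(3 ^ n - 3) div 2 = m" "((3::nat) ^ n - 1) div 2 = Suc m"
    "(3 ^ Suc n - 3) div 2 = 3 * Suc m" "((3::nat) ^ Suc n - 1) div 2 = 3 * Suc m + 1"
proof -
  have "odd ((3::nat) ^ n)" "(3::nat) ^ n \<ge> 3"
    using assms self_le_power[of "3::nat" n] by simp_all
  then obtain m where "(3::nat) ^ n = 2 * m + 3"
    by (metis add.commute even_add even_numeral le_add_diff_inverse odd_numeral evenE)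
  then show ?thesis
    by (intro that[of m]) simp_all
qed

lemma
  fixes w x y z :: "'a::idom"
  assumes "n \<ge> 1"
  shows Q_Suc: "Q (Suc n) w x y z = R n w x y z + (w * x * y + w * z + x * z) * Q n w x y z"
    and R_Suc: "R (Suc n) w x y z = (w + x + y) * R n w x y z + w * x * z * Q n w x y z"
proof -
  obtain m where "(3 ^ n - 3) div 2 = m" "((3::nat) ^ n - 1) div 2 = Suc m"
    "(3 ^ Suc n - 3) div 2 = 3 * Suc m" "((3::nat) ^ Suc n - 1) div 2 = 3 * Suc m + 1"
    using index_shapes[OF assms] .
  then show "Q (Suc n) w x y z = R n w x y z + (w * x * y + w * z + x * z) * Q n w x y z"
    and "R (Suc n) w x y z = (w + x + y) * R n w x y z + w * x * z * Q n w x y z"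
    unfolding Q_def R_def by (simp_all only: S_triple S_triple_plus_1)
qed

text \<open>
  Sum and difference are the eigenvectors of the symmetric matrix with rows \<open>(a, 1)\<close> and \<open>(1, a)\<close>, where
  \<open>a = y + 2\<close>; the eigenvalues are \<open>a + 1\<close> and \<open>a - 1\<close>. The start is \<open>n = 1\<close> because the value
  \<open>0\<close> that the recurrence would want for \<open>Q\<close> at \<open>n = 0\<close> is not the one that truncated subtraction gives.
\<close>

lemma R_Q_closed_form:
  fixes y :: "'a::idom"
  assumes "n \<ge> 1"
  shows "R n 1 1 y 1 + Q n 1 1 y 1 = (y + 3) ^ n \<and> R n 1 1 y 1 - Q n 1 1 y 1 = (y + 1) ^ n"
  using assms
proof (induction n rule: dec_induct)
  case base
  then show ?case
    using R_1[of 1 1 y 1] Q_1[of 1 1 y 1] by simp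
next
  case (step n)
  have "R (Suc n) 1 1 y 1 + Q (Suc n) 1 1 y 1 = (y + 3) * (R n 1 1 y 1 + Q n 1 1 y 1)"
    "R (Suc n) 1 1 y 1 - Q (Suc n) 1 1 y 1 = (y + 1) * (R n 1 1 y 1 - Q n 1 1 y 1)"
    by (simp_all add: Q_Suc[OF step.hyps(1)] R_Suc[OF step.hyps(1)] algebra_simps)
  then show ?case
    using step.IH by simp
qed

lemma poly_S: "poly (S n w x y z) t = S n (poly w t) (poly x t) (poly y t) (poly z t)"
  for t :: "'a::comm_ring_1"
  by (rule S_hom) simp_all

lemma poly_Q1: "poly (Q1 n) z = Q n 1 1 z 1" and poly_R1: "poly (R1 n) z = R n 1 1 z 1"
  by (simp_all add: Q1_def R1_def Q_def R_def poly_S)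

lemma poly_Q1_eq:
  assumes "n \<ge> 1"
  shows "poly (Q1 n) z = ((z + 3) ^ n - (z + 1) ^ n) / 2"
  using R_Q_closed_form[OF assms, of z]
  by (auto simp: poly_Q1 field_simps)

text \<open>This also holds for \<open>n = 0\<close>, in contrast to the formula for \<open>Q1\<close>.\<close>

lemma poly_R1_eq: "poly (R1 n) z = ((z + 3) ^ n + (z + 1) ^ n) / 2"
proof (cases "n = 0")
  case True
  then show ?thesis
    by (simp add: poly_R1 R_0)
next
  case False
  then show ?thesis
    using R_Q_closed_form[of n z] by (auto simp: poly_R1 field_simps)
qed

text \<open>A point equidistant from \<open>-3\<close> and \<open>-1\<close> lies on the perpendicular bisector of the two.\<close>

lemma Re_eq_if_power_norm_eq:
  fixes z :: complex
  assumes "n \<ge> 1" "norm ((z + 3) ^ n) = norm ((z + 1) ^ n)"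
  shows "Re z = -2"
proof -
  have "norm (z + 3) = norm (z + 1)"
    using assms power_eq_imp_eq_base[of "norm (z + 3)" n "norm (z + 1)"] by (simp add: norm_power)
  then have "(Re z + 3)\<^sup>2 = (Re z + 1)\<^sup>2"
    by (simp add: cmod_def)
  then show ?thesis
    by (simp add: power2_eq_square algebra_simps)
qed

lemma Re_zero_Q1:
  assumes "n \<ge> 1" "poly (Q1 n) z = 0"
  shows "Re z = -2"
proof (rule Re_eq_if_power_norm_eq[OF assms(1)])
  show "norm ((z + 3) ^ n) = norm ((z + 1) ^ n)"
    using assms by (simp add: poly_Q1_eq)
qed

lemma Re_zero_R1:
  assumes "poly (R1 n) z = 0"
  shows "Re z = -2"
proof (rule Re_eq_if_power_norm_eq)
  show "n \<ge> 1"
    using assms by (cases n) (simp_all add: poly_R1_eq)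
  have "(z + 3) ^ n = - ((z + 1) ^ n)"
    using assms by (simp add: poly_R1_eq add_eq_0_iff2)
  then show "norm ((z + 3) ^ n) = norm ((z + 1) ^ n)"
    by (simp only: norm_minus_cancel)
qed

lemma Q1_at_minus_2: "n \<ge> 1 \<Longrightarrow> poly (Q1 n) (-2) = 0 \<longleftrightarrow> even n"
  by (cases "even n") (simp_all add: poly_Q1_eq)

lemma R1_at_minus_2: "poly (R1 n) (-2) = 0 \<longleftrightarrow> odd n"
  by (cases "even n") (simp_all add: poly_R1_eq)

lemma real_with_Re_minus_2: "z \<in> \<real> \<Longrightarrow> Re z = -2 \<Longrightarrow> z = -2"
  by (simp add: complex_eq_iff complex_is_Real_iff)

theorem proposition4p6:
  shows "(\<forall>n\<ge>1. \<forall>z. poly (Q1 n) z = 0 \<longrightarrow> Re z = -2) \<and>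
         (\<forall>n. \<forall>z. poly (R1 n) z = 0 \<longrightarrow> Re z = -2) \<and>
         (\<forall>n\<ge>1. poly (Q1 (2 * n)) (-2) = 0) \<and>
         (\<forall>n. poly (R1 (2 * n + 1)) (-2) = 0) \<and>
         (\<forall>n\<ge>1. \<forall>z. poly (Q1 n) z = 0 \<and> z \<in> \<real> \<longrightarrow> even n \<and> z = -2) \<and>
         (\<forall>n. \<forall>z. poly (R1 n) z = 0 \<and> z \<in> \<real> \<longrightarrow> odd n \<and> z = -2)"
proof (intro conjI allI impI; (elim conjE)?)
  show "Re z = -2" if "n \<ge> 1" "poly (Q1 n) z = 0" for n z
    using that by (rule Re_zero_Q1)
  show "Re z = -2" if "poly (R1 n) z = 0" for n z
    using that by (rule Re_zero_R1)
  show "poly (Q1 (2 * n)) (-2) = 0" if "n \<ge> 1" for n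
    using that by (simp add: Q1_at_minus_2)
  show "poly (R1 (2 * n + 1)) (-2) = 0" for n
    by (simp add: R1_at_minus_2)
  fix n z
  show "z = -2" if "n \<ge> 1" "poly (Q1 n) z = 0" "z \<in> \<real>"
    using that Re_zero_Q1 real_with_Re_minus_2 by blast
  then show "even n" if "n \<ge> 1" "poly (Q1 n) z = 0" "z \<in> \<real>"
    using that Q1_at_minus_2 by blast
  show "z = -2" if "poly (R1 n) z = 0" "z \<in> \<real>"
    using that Re_zero_R1 real_with_Re_minus_2 by blast
  then show "odd n" if "poly (R1 n) z = 0" "z \<in> \<real>"
    using that R1_at_minus_2 by blast
qed

end
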